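(* Let $(X_i,Y_i)\in\mathbb{R}^p\times\mathbb{R}$, $i=1,\dots,n$, be arbitrary sample points, indexed so that $0<Y_1\le Y_2\le\dots\le Y_m$ and $Y_i\le 0$ for $i=m+1,\dots,n$. Let $k\ge 1$ be a fixed integer. Then the Generalized Approximation Algorithm (described in the context) with parameter $k$ is an $\frac nk$-approximation algorithm for the One-Node-ReLU problem; that is, if $(\hat\beta,\hat\beta_0)$ is the solution returned by the algorithm, $$z^{approx}=\sum_{i=1}^n\bigl(\max\{0,X_i^{\top}\hat\beta+\hat\beta_0\}-Y_i\bigr)^2$$ is its objective value, and $$z^{\mathrm{OPT}}=\min_{(\beta,\beta_0)\in\mathbb{R}^p\times\mathbb{R}}\ \sum_{i=1}^n\bigl(\max\{0,X_i^{\top}\beta+\beta_0\}-Y_i\bigr)^2$$ is the global optimal value of the One-Node-ReLU problem, then $$z^{\mathrm{OPT}}\le z^{approx}\le\frac nk\,z^{\mathrm{OPT}} .$$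
   Context: The One-Node-ReLU problem is the minimization problem defining $z^{\mathrm{OPT}}$ (the constant factor $1/n$ in front of the sum of squares is dropped, as it does not change the optimal solution). Write $[m]=\{1,\dots,m\}$. Define $\sigma:\mathbb{R}\times\mathbb{R}\to\mathbb{R}$ by $\sigma(x,y)=(x-y)^2$ if $x>2y$ and $\sigma(x,y)=y^2$ if $x\le 2y$. Define $$\phi(\beta,\beta_0)=\sum_{i=m+1}^n(\max\{0,X_i^{\top}\beta+\beta_0\}-Y_i)^2 ,$$ and for $I\subseteq[m]$ (the "active set"; $[m]\setminus I$ is the "inactive set") $$f_I^{\sigma}(\beta,\beta_0)=\sum_{i\in I}(X_i^{\top}\beta+\beta_0-Y_i)^2+\sum_{i\in[m]\setminus I}\sigma(X_i^{\top}\beta+\beta_0,Y_i),\qquad z^{\sigma}(I)=\min_{(\beta,\beta_0)\in\mathbb{R}^p\times\mathbb{R}} \bigl[f_I^{\sigma}(\beta,\beta_0)+\phi(\beta,\beta_0)\bigr].$$ Generalized Approximation Algorithm with parameter $k$ (a fixed integer $k\ge1$): for each $j=1,\dots,k$ and each choice of distinct integers $0\le i_1<i_2<\dots<i_j\le m$, take the inactive set to be $\{1,\dots,i_1\}\cup\{i_2,\dots,i_j\}$ (where $\{1,\dots,i_1\}=\emptyset$ if $i_1=0$, and for $j=1$ the inactive set is just $\{1,\dots,i_1\}$), let the active set $I$ be its complement in $[m]$, and compute $z^{\sigma}(I)$ together with a minimizer $(\beta^I,\beta^I_0)$ of the convex function $f_I^{\sigma}+\phi$. Return $(\hat\beta,\hat\beta_0)=(\beta^I,\beta_0^I)$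 for an $I$ attaining the smallest value $z^{\sigma}(I)$ among all the sets $I$ examined.
   Formalization: The formal theorem adds the assumption k ≤ n; for k > n the ratio n/k is below 1 and the stated bound fails whenever the optimal value is positive (e.g. n=1, m=0, Y_1=-1, k=2). *)

theory Defs
  imports "HOL-Analysis.Analysis"
begin

text \<open>
  Samples \<open>X i\<close>, \<open>Y i\<close> are used for indices \<open>i \<in> {1..n}\<close> only.  A point \<open>w\<close> is a pair
  \<open>(\<beta>, \<beta>\<^sub>0)\<close>, and \<open>aff (X i) w\<close> is the preactivation \<open>X\<^sub>i\<^sup>T \<beta> + \<beta>\<^sub>0\<close>.
\<close>

definition aff :: "real ^ 'p \<Rightarrow> (real ^ 'p) \<times> real \<Rightarrow> real" where
  "aff x w = x \<bullet> fst w + snd w"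

definition relu_obj ::
  "nat \<Rightarrow> (nat \<Rightarrow> real ^ 'p) \<Rightarrow> (nat \<Rightarrow> real) \<Rightarrow> (real ^ 'p) \<times> real \<Rightarrow> real" where
  "relu_obj n X Y w = (\<Sum>i=1..n. (max 0 (aff (X i) w) - Y i)\<^sup>2)"

text \<open>
  Optimal values are infima over all of \<open>\<real>\<^sup>p \<times> \<real>\<close> of functions that are bounded below by 0, so
  they agree with the minimum whenever it is attained.
\<close>

definition z_opt :: "nat \<Rightarrow> (nat \<Rightarrow> real ^ 'p) \<Rightarrow> (nat \<Rightarrow> real) \<Rightarrow> real" where
  "z_opt n X Y = (INF w. relu_obj n X Y w)"

definition sigma :: "real \<Rightarrow> real \<Rightarrow> real" where
  "sigma x y = (if x > 2 * y then (x - y)\<^sup>2 else y\<^sup>2)"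

definition phi ::
  "nat \<Rightarrow> nat \<Rightarrow> (nat \<Rightarrow> real ^ 'p) \<Rightarrow> (nat \<Rightarrow> real) \<Rightarrow> (real ^ 'p) \<times> real \<Rightarrow> real" where
  "phi m n X Y w = (\<Sum>i=m+1..n. (max 0 (aff (X i) w) - Y i)\<^sup>2)"

definition f_sigma ::
  "nat \<Rightarrow> (nat \<Rightarrow> real ^ 'p) \<Rightarrow> (nat \<Rightarrow> real) \<Rightarrow> nat set \<Rightarrow> (real ^ 'p) \<times> real \<Rightarrow> real" where
  "f_sigma m X Y I w =
     (\<Sum>i\<in>I. (aff (X i) w - Y i)\<^sup>2) + (\<Sum>i\<in>{1..m} - I. sigma (aff (X i) w) (Y i))"

definition z_sigma ::
  "nat \<Rightarrow> nat \<Rightarrow> (nat \<Rightarrow> real ^ 'p) \<Rightarrow> (nat \<Rightarrow> real) \<Rightarrow> nat set \<Rightarrow> real" where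
  "z_sigma m n X Y I = (INF w. f_sigma m X Y I w + phi m n X Y w)"

text \<open>
  The indices \<open>0 \<le> i\<^sub>1 < \<dots> < i\<^sub>j \<le> m\<close> are the values of a function \<open>t\<close> on \<open>{1..j}\<close>.  For
  \<open>j = 1\<close> the set \<open>{2..j}\<close> is empty, and \<open>{1..t 1}\<close> is empty if \<open>t 1 = 0\<close>.
\<close>

definition inactive_sets :: "nat \<Rightarrow> nat \<Rightarrow> nat set set" where
  "inactive_sets k m =
     {{1..t 1} \<union> t ` {2..j} | j t.
        j \<in> {1..k} \<and> strict_mono_on {1..j} t \<and> t ` {1..j} \<subseteq> {0..m}}"

definition examined_sets :: "nat \<Rightarrow> nat \<Rightarrow> nat set set" where
  "examined_sets k m = {{1..m} - N | N. N \<in> inactive_sets k m}"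

text \<open>
  The algorithm leaves open which minimizer and which best active set are chosen, so its output is
  described by a relation: \<open>w\<close> is a possible output.
\<close>

definition gen_approx_output ::
  "nat \<Rightarrow> nat \<Rightarrow> nat \<Rightarrow> (nat \<Rightarrow> real ^ 'p) \<Rightarrow> (nat \<Rightarrow> real) \<Rightarrow> (real ^ 'p) \<times> real \<Rightarrow> bool" where
  "gen_approx_output k m n X Y w \<longleftrightarrow>
     (\<exists>I. is_arg_min (z_sigma m n X Y) (\<lambda>J. J \<in> examined_sets k m) I \<and>
          is_arg_min (\<lambda>v. f_sigma m X Y I v + phi m n X Y v) (\<lambda>_. True) w)"

end

theory Submission
  imports Defs
begin

text \<open>
  For \<open>y > 0\<close> both \<open>(x - y)\<^sup>2\<close> and \<open>sigma x y\<close> dominate \<open>(max 0 x - y)\<^sup>2\<close>, so the objective value of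
  a minimizer for an active set \<open>I\<close> is at most \<open>z_sigma I\<close>.  It therefore suffices to find, for an
  optimal \<open>w\<close>, one examined set whose surrogate objective at \<open>w\<close> is at most \<open>n / k\<close> times the true
  one.  The objectives are not coercive, so that the minima are attained needs its own argument.
\<close>

section \<open>The loss functions\<close>

text \<open>Both branches give \<open>y\<^sup>2\<close> at \<open>x = 2 * y\<close>. Clamping the
  argument there turns \<open>sigma\<close> into a square of a continuous function, which makes
  nonnegativity and continuity immediate.\<close>

lemma sigma_altdef: "sigma x y = (max x (2 * y) - y)\<^sup>2"
  by (simp add: sigma_def max_def)

lemma relu_le_square: "0 < y \<Longrightarrow> (max 0 x - y)\<^sup>2 \<le> (x - y)\<^sup>2" for x y :: real
  by (auto simp: abs_le_square_iff[symmetric])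

lemma relu_le_sigma: "0 < y \<Longrightarrow> (max 0 x - y)\<^sup>2 \<le> sigma x y"
  by (auto simp: sigma_def abs_le_square_iff[symmetric])

lemma sigma_nonpos: "0 < y \<Longrightarrow> x \<le> 0 \<Longrightarrow> sigma x y = y\<^sup>2"
  by (simp add: sigma_def)

text \<open>The price of declaring an activated sample inactive: above \<open>2 * y\<close> the two
  losses coincide, and below it \<open>sigma\<close> is just \<open>y\<^sup>2\<close>.\<close>

lemma sigma_le_relu_plus: "0 < y \<Longrightarrow> sigma x y \<le> (max 0 x - y)\<^sup>2 + y\<^sup>2"
  by (simp add: sigma_def)

text \<open>With a single sum over \<open>{1..n}\<close>, the surrogate can be compared with the
  true objective term by term, and it has the shape that the attainment argument needs.\<close>

lemma f_sigma_phi_eq_sum: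
  assumes "m \<le> n" "I \<subseteq> {1..m}"
  shows "f_sigma m X Y I w + phi m n X Y w = (\<Sum>i=1..n.
    (if i \<in> I then (aff (X i) w - Y i)\<^sup>2
     else if i \<le> m then sigma (aff (X i) w) (Y i) else (max 0 (aff (X i) w) - Y i)\<^sup>2))"
    (is "_ = sum ?h _")
proof -
  have "sum ?h {1..n} = sum ?h {1..m} + sum ?h {m+1..n}"
    using assms(1) sum.ub_add_nat[of 1 m ?h "n - m"] by simp
  also have "sum ?h {1..m} = sum ?h ({1..m} - I) + sum ?h I"
    by (rule sum.subset_diff) (use assms(2) in auto)
  also have "sum ?h ({1..m} - I) = (\<Sum>i\<in>{1..m} - I. sigma (aff (X i) w) (Y i))"
    by (rule sum.cong) auto
  also have "sum ?h I = (\<Sum>i\<in>I. (aff (X i) w - Y i)\<^sup>2)"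
    by (rule sum.cong) auto
  also have "sum ?h {m+1..n} = phi m n X Y w"
    unfolding phi_def by (rule sum.cong) (use assms(2) in auto)
  finally show ?thesis by (simp add: f_sigma_def)
qed

lemma z_sigma_le: "z_sigma m n X Y I \<le> f_sigma m X Y I w + phi m n X Y w"
proof -
  have "0 \<le> f_sigma m X Y I v + phi m n X Y v" for v
    by (simp add: f_sigma_def phi_def sigma_altdef sum_nonneg)
  then show ?thesis
    unfolding z_sigma_def by (intro cINF_lower bdd_belowI[of _ 0]) auto
qed

lemma z_opt_le: "z_opt n X Y \<le> relu_obj n X Y w"
  unfolding z_opt_def relu_obj_def
  by (rule cINF_lower) (auto intro!: bdd_belowI[of _ 0] sum_nonneg)

lemma relu_obj_le_f_sigma_phi:
  assumes "m \<le> n" "I \<subseteq> {1..m}" "\<forall>i\<in>{1..m}. 0 < Y i"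
  shows "relu_obj n X Y w \<le> f_sigma m X Y I w + phi m n X Y w"
  unfolding relu_obj_def f_sigma_phi_eq_sum[OF assms(1,2)]
proof (rule sum_mono)
  fix i assume "i \<in> {1..n}"
  then have "0 < Y i" if "i \<in> I \<or> i \<le> m" using that assms(2,3) by auto
  then show "(max 0 (aff (X i) w) - Y i)\<^sup>2 \<le> (if i \<in> I then (aff (X i) w - Y i)\<^sup>2
      else if i \<le> m then sigma (aff (X i) w) (Y i) else (max 0 (aff (X i) w) - Y i)\<^sup>2)"
    by (simp add: relu_le_square relu_le_sigma)
qed

section \<open>The examined sets\<close>

lemma inactive_sets_bounds:
  assumes "N \<in> inactive_sets k m"
  shows "N \<subseteq> {1..m}"
proof -
  obtain j t where N: "N = {1..t 1} \<union> t ` {2..j}" and j: "j \<in> {1..k}"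
    and mono: "strict_mono_on {1..j} t" and im: "t ` {1..j} \<subseteq> {0..m}"
    using assms by (auto simp: inactive_sets_def)
  have "t 1 \<le> m" using im j by (auto simp: image_subset_iff)
  moreover have "1 \<le> t i \<and> t i \<le> m" if "i \<in> {2..j}" for i
    using strict_mono_onD[OF mono, of 1 i] im that by (auto simp: image_subset_iff)
  ultimately show ?thesis unfolding N by auto
qed

text \<open>Replaces increasing index sequences by sets: \<open>T\<close> is the set of values of
  \<open>t\<close>, and its minimum is the end of the initial segment. The index 0 may belong to
  \<open>T\<close> and then encodes an empty segment.\<close>

lemma Min_inactive_set:
  assumes "T \<noteq> {}" "T \<subseteq> {0..m}" "card T \<le> k"
  shows "{1..Min T} \<union> (T - {Min T}) \<in> inactive_sets k m"
proof -
  have fin: "finite T" using assms(2) finite_subset by blast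
  then obtain h where h: "bij_betw h {..<card T} T" "strict_mono_on {..<card T} h"
    using ex_bij_betw_strict_mono_card by blast
  \<comment> \<open>The enumeration \<open>h\<close> starts at 0, whereas the indices
    \<open>t\<close> start at 1.\<close>
  let ?t = "\<lambda>i. h (i - 1)"
  have card: "1 \<le> card T" using fin assms(1) by (simp add: Suc_le_eq card_gt_0_iff)
  have im: "?t ` {1..card T} = T"
  proof -
    have "(\<lambda>i. i - 1) ` {1..card T} = {..<card T}"
    proof (intro equalityI subsetI)
      fix i assume "i \<in> {..<card T}"
      then show "i \<in> (\<lambda>i. i - 1) ` {1..card T}" by (intro image_eqI[of _ _ "Suc i"]) auto
    qed auto
    then show ?thesis using h(1) by (metis bij_betw_imp_surj_on image_image)
  qed
  have mono: "strict_mono_on {1..card T} ?t"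
    by (intro strict_mono_onI strict_mono_onD[OF h(2)]) auto
  have t1: "?t 1 = Min T"
  proof (rule Min_eqI[symmetric])
    fix b assume "b \<in> T"
    then obtain i where "i \<in> {1..card T}" "b = ?t i" using im by blast
    then show "?t 1 \<le> b" using strict_mono_onD[OF mono, of 1 i] by (cases "i = 1") auto
  next
    show "?t 1 \<in> T" using im card by (metis atLeastAtMost_iff imageI order_refl)
  qed (rule fin)
  have range: "{1..card T} = insert 1 {2..card T}" using card by auto
  have "T = insert (Min T) (?t ` {2..card T})"
    using im[symmetric] unfolding range image_insert t1 .
  moreover have "Min T \<notin> ?t ` {2..card T}"
  proof
    assume "Min T \<in> ?t ` {2..card T}"
    then obtain i where i: "i \<in> {2..card T}" "Min T = ?t i" by blast
    have "?t 1 < ?t i" by (rule strict_mono_onD[OF mono]) (use i(1) in auto)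
    then show False unfolding t1 i(2)[symmetric] by simp
  qed
  ultimately have "T - {Min T} = ?t ` {2..card T}" by blast
  then show ?thesis
    unfolding inactive_sets_def using t1 mono im card assms(2,3)
    by (intro CollectI exI[of _ "card T"] exI[of _ ?t]) auto
qed

text \<open>The top \<open>k\<close> elements are collected one at a time: each step adds the
  maximum of what remains.\<close>

lemma ex_upper_subset_card:
  fixes A :: "'a::linorder set"
  assumes "finite A" "k \<le> card A"
  shows "\<exists>T\<subseteq>A. card T = k \<and> (\<forall>a\<in>A - T. \<forall>b\<in>T. a < b)"
  using assms(2)
proof (induction k)
  case 0
  show ?case by (intro exI[of _ "{}"]) auto
next
  case (Suc k)
  then obtain T where T: "T \<subseteq> A" "card T = k" "\<forall>a\<in>A - T. \<forall>b\<in>T. a < b"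
    by auto
  have fin: "finite T" "finite (A - T)" using T(1) assms(1) finite_subset by auto
  have "A - T \<noteq> {}" using Suc.prems T fin by (metis Diff_eq_empty_iff card_mono not_less_eq_eq)
  then have M: "Max (A - T) \<in> A - T" using fin by (intro Max_in)
  have "a < Max (A - T)" if "a \<in> A - insert (Max (A - T)) T" for a
    using that Max_ge[OF fin(2), of a] by fastforce
  with M T fin show ?case
    by (intro exI[of _ "insert (Max (A - T)) T"]) auto
qed

lemma examined_sets_bounds: "I \<in> examined_sets k m \<Longrightarrow> I \<subseteq> {1..m}"
  by (auto simp: examined_sets_def)

text \<open>
  If at least \<open>k\<close> of the samples with \<open>Y i > 0\<close> are not activated at \<open>w\<close>, the \<open>k\<close> largest of their
  indices are kept and everything below the smallest of these, \<open>i\<^sub>1\<close>, is declared inactive.  Each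
  activated sample below \<open>i\<^sub>1\<close> costs at most \<open>(Y i\<^sub>1)\<^sup>2\<close> extra, there are at most \<open>n - k\<close> of them, and
  the \<open>k\<close> kept samples each contribute at least \<open>(Y i\<^sub>1)\<^sup>2\<close> to the objective.
\<close>

lemma ex_examined_set_le:
  assumes "m \<le> n" and pos: "\<forall>i\<in>{1..m}. 0 < Y i" and mono: "mono_on {1..m} Y"
    and k: "1 \<le> k" "k \<le> n"
  shows "\<exists>I\<in>examined_sets k m.
    f_sigma m X Y I w + phi m n X Y w \<le> real n / real k * relu_obj n X Y w"
proof -
  let ?x = "\<lambda>i. aff (X i) w"
  let ?r = "\<lambda>i. (max 0 (?x i) - Y i)\<^sup>2"
  define Z where "Z = {i \<in> {1..m}. ?x i \<le> 0}"
  have Z: "finite Z" "Z \<subseteq> {1..m}" by (auto simp: Z_def)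
  have nonneg: "0 \<le> relu_obj n X Y w" by (simp add: relu_obj_def sum_nonneg)
  show ?thesis
  proof (cases "card Z < k")
    case True
    \<comment> \<open>With fewer than \<open>k\<close> unactivated samples there is room for the
      dummy index 0 as \<open>i\<^sub>1\<close>. Dropping this minimum leaves exactly
      \<open>Z\<close> as inactive set.\<close>
    have "0 \<notin> Z" using Z by auto
    moreover have "Min (insert 0 Z) = 0" using Z(1) by (intro Min_eqI) auto
    moreover have "card (insert 0 Z) \<le> k" using True Z(1) by (simp add: card_insert_if)
    moreover have "insert 0 Z \<subseteq> {0..m}" using Z(2) by auto
    ultimately have "Z \<in> inactive_sets k m"
      using Min_inactive_set[of "insert 0 Z" m k] by simp
    then have ex: "{1..m} - Z \<in> examined_sets k m" by (auto simp: examined_sets_def)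
    \<comment> \<open>No loss occurs: on \<open>Z\<close> both \<open>sigma\<close> and the ReLU
      loss equal \<open>(Y i)\<^sup>2\<close>, and off \<open>Z\<close> the preactivation is
      positive.\<close>
    have "f_sigma m X Y ({1..m} - Z) w + phi m n X Y w = relu_obj n X Y w"
      unfolding relu_obj_def f_sigma_phi_eq_sum[OF assms(1) Diff_subset]
      by (rule sum.cong) (use pos in \<open>auto simp: Z_def sigma_nonpos max_absorb1\<close>)
    also have "\<dots> \<le> real n / real k * relu_obj n X Y w"
      using mult_right_mono[OF _ nonneg, of 1 "real n / real k"] k by simp
    finally show ?thesis using ex by blast
  next
    case False
    then obtain T where T: "T \<subseteq> Z" "card T = k" "\<forall>a\<in>Z - T. \<forall>b\<in>T. a < b"
      using ex_upper_subset_card[OF Z(1), of k] by auto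
    have fin: "finite T" using T(1) Z(1) finite_subset by blast
    have Tn: "T \<subseteq> {1..n}" using T(1) Z(2) assms(1) by force
    have ne: "T \<noteq> {}" using T(2) k by auto
    define i1 where "i1 = Min T"
    have i1: "i1 \<in> T" "\<And>b. b \<in> T \<Longrightarrow> i1 \<le> b" using fin ne by (auto simp: i1_def)
    have i1m: "i1 \<in> {1..m}" using i1(1) T(1) Z(2) by auto
    define N where "N = {1..i1} \<union> (T - {i1})"
    have N: "N \<in> inactive_sets k m"
      unfolding N_def i1_def by (rule Min_inactive_set) (use T ne Z in auto)
    have Nm: "N \<subseteq> {1..m}" using N by (rule inactive_sets_bounds)
    \<comment> \<open>Members of \<open>Z\<close> outside \<open>T\<close> lie below
      \<open>i1\<close>, hence in the initial segment. So only samples with positive preactivation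
      are declared active, and these cost nothing extra.\<close>
    have ZN: "Z \<subseteq> N"
    proof
      fix a assume a: "a \<in> Z"
      then have "a < i1" if "a \<notin> T" using T(3) i1(1) that by blast
      moreover have "1 \<le> a" using a Z(2) by auto
      moreover have "1 \<le> i1" using i1m by simp
      ultimately show "a \<in> N" unfolding N_def by (cases "a = i1"; cases "a \<in> T") auto
    qed
    let ?I = "{1..m} - N"
    let ?c = "(Y i1)\<^sup>2"
    let ?A = "{1..n} - T"
    \<comment> \<open>The charge \<open>?c\<close> is granted to every index outside
      \<open>T\<close>, whether or not it is incurred, so that exactly \<open>n - k\<close> charges
      are counted.\<close>
    have "f_sigma m X Y ?I w + phi m n X Y w \<le> (\<Sum>i=1..n. ?r i + (if i \<in> ?A then ?c else 0))"
      unfolding f_sigma_phi_eq_sum[OF assms(1) Diff_subset]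
    proof (rule sum_mono)
      fix i assume i: "i \<in> {1..n}"
      have "sigma (?x i) (Y i) \<le> ?r i + (if i \<in> ?A then ?c else 0)" if im: "i \<in> N"
      proof (cases "i \<in> Z")
        case True
        then have "0 < Y i" "?x i \<le> 0" using pos by (simp_all add: Z_def)
        then show ?thesis by (simp add: sigma_nonpos max_absorb1)
      next
        \<comment> \<open>Since \<open>T\<close> lies in \<open>Z\<close>, this index entered
          \<open>N\<close> through the initial segment, and monotonicity bounds \<open>Y i\<close>
          by \<open>Y i1\<close>.\<close>
        case nz: False
        then have "i \<notin> T" "i \<le> i1" using T(1) im by (auto simp: N_def)
        then have "Y i \<le> Y i1" using mono_onD[OF mono, of i i1] i1m Nm im by auto
        then have "(Y i)\<^sup>2 \<le> ?c" using pos Nm im by (intro power_mono) (auto simp: less_imp_le)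
        then show ?thesis
          using sigma_le_relu_plus[of "Y i" "?x i"] pos Nm im i \<open>i \<notin> T\<close> by auto
      qed
      moreover have "(?x i - Y i)\<^sup>2 = ?r i" if "i \<in> ?I"
        using that ZN by (auto simp: Z_def)
      ultimately show "(if i \<in> ?I then (?x i - Y i)\<^sup>2
          else if i \<le> m then sigma (?x i) (Y i) else ?r i) \<le> ?r i + (if i \<in> ?A then ?c else 0)"
        using i by auto
    qed
    also have "\<dots> = relu_obj n X Y w + (\<Sum>i\<in>{1..n} \<inter> ?A. ?c)"
      unfolding sum.distrib relu_obj_def by (subst sum.inter_restrict) simp_all
    also have "{1..n} \<inter> ?A = ?A" by blast
    also have "(\<Sum>i\<in>?A. ?c) = real (card ?A) * ?c" by simp
    also have "card ?A = n - k"
      using card_Diff_subset[OF fin Tn] T(2) by simp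
    finally have le: "f_sigma m X Y ?I w + phi m n X Y w
      \<le> relu_obj n X Y w + (real n - real k) * ?c" using k by (simp add: of_nat_diff)
    have "real k * ?c = (\<Sum>i\<in>T. ?c)" by (simp add: T(2))
    also have "\<dots> \<le> (\<Sum>i\<in>T. ?r i)"
    proof (rule sum_mono)
      fix i assume i: "i \<in> T"
      then have "Y i1 \<le> Y i" using mono_onD[OF mono, of i1 i] i1(2)[OF i] i1m T(1) Z(2) by auto
      then have "?c \<le> (Y i)\<^sup>2" using pos i1m by (intro power_mono) (auto simp: less_imp_le)
      also have "\<dots> = ?r i" using i T(1) by (auto simp: Z_def max_absorb1)
      finally show "?c \<le> ?r i" .
    qed
    also have "\<dots> \<le> relu_obj n X Y w"
      unfolding relu_obj_def by (rule sum_mono2) (use Tn in auto)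
    finally have "?c \<le> relu_obj n X Y w / real k" using k by (simp add: field_simps)
    then have "(real n - real k) * ?c \<le> (real n - real k) * (relu_obj n X Y w / real k)"
      using k by (intro mult_left_mono) auto
    also have "\<dots> = real n / real k * relu_obj n X Y w - relu_obj n X Y w"
      using k by (simp add: field_simps)
    finally have "f_sigma m X Y ?I w + phi m n X Y w \<le> real n / real k * relu_obj n X Y w"
      using le by linarith
    moreover have "?I \<in> examined_sets k m" using N by (auto simp: examined_sets_def)
    ultimately show ?thesis by blast
  qed
qed

section \<open>Attainment of the minima\<close>

text \<open>The sum is a norm on \<open>span B\<close>: a vector of the span where it vanishes is
  orthogonal to \<open>B\<close> and hence to itself. Its minimum over the compact unit sphere of
  the span serves as \<open>e\<close>. Bounded inner products thus bound the span component.\<close>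

lemma norm_le_sum_inner_on_span:
  fixes B :: "'a::euclidean_space set"
  assumes "finite B"
  obtains e where "e > 0" "\<And>y. y \<in> span B \<Longrightarrow> e * norm y \<le> (\<Sum>b\<in>B. \<bar>b \<bullet> y\<bar>)"
proof (cases "span B \<inter> sphere 0 1 = {}")
  case True
  have "y = 0" if "y \<in> span B" for y
  proof (rule ccontr)
    assume "y \<noteq> 0"
    then have "y /\<^sub>R norm y \<in> span B \<inter> sphere 0 1"
      using that by (simp add: span_scale)
    with True show False by blast
  qed
  then show ?thesis using that[of 1] by (force simp: sum_nonneg)
next
  case False
  let ?q = "\<lambda>y. \<Sum>b\<in>B. \<bar>b \<bullet> y\<bar>"
  have "compact (span B \<inter> sphere 0 1)"
    by (simp add: closed_Int_compact)
  moreover have "continuous_on (span B \<inter> sphere 0 1) ?q"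
    by (intro continuous_intros)
  ultimately obtain y0 where y0: "y0 \<in> span B" "norm y0 = 1"
      and min: "\<And>y. y \<in> span B \<Longrightarrow> norm y = 1 \<Longrightarrow> ?q y0 \<le> ?q y"
    using continuous_attains_inf[OF _ False, of ?q] by (auto simp: dist_norm)
  have "?q y0 \<noteq> 0"
  proof
    assume "?q y0 = 0"
    then have "\<And>b. b \<in> B \<Longrightarrow> orthogonal y0 b"
      using assms by (simp add: sum_nonneg_eq_0_iff orthogonal_def inner_commute)
    then have "orthogonal y0 y0" using y0(1) orthogonal_to_span by blast
    with y0(2) show False by (simp add: orthogonal_def)
  qed
  then have "?q y0 > 0" by (simp add: order_less_le sum_nonneg)
  moreover have "?q y0 * norm y \<le> ?q y" if "y \<in> span B" for y
  proof (cases "y = 0")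
    case nz: False
    have "?q y0 \<le> ?q (y /\<^sub>R norm y)"
      using that nz by (intro min) (simp_all add: span_scale)
    also have "\<dots> = ?q y / norm y"
      by (simp add: abs_mult sum_distrib_left divide_inverse mult.commute)
    finally show ?thesis using nz by (simp add: pos_le_divide_eq)
  qed (simp add: sum_nonneg)
  ultimately show ?thesis using that by blast
qed

text \<open>A sequence that does not tend to -infinity exceeds some level \<open>L\<close>
  infinitely often. Those indices give a subsequence bounded on both sides. Both alternatives
  survive further subsequences, so the members of \<open>S\<close> can be treated one after
  another.\<close>

lemma subseq_bounded_or_at_bot:
  fixes u :: "'i \<Rightarrow> nat \<Rightarrow> real"
  assumes "finite S" "\<And>i. i \<in> S \<Longrightarrow> bdd_above (range (u i))"
  shows "\<exists>r. strict_mono r \<and>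
    (\<forall>i\<in>S. bounded (range (u i \<circ> r)) \<or> filterlim (u i \<circ> r) at_bot sequentially)"
  using assms
proof (induction S rule: finite_induct)
  case empty
  show ?case using strict_mono_id by blast
next
  case (insert j S)
  then obtain r where r: "strict_mono r"
    and rS: "\<And>i. i \<in> S \<Longrightarrow> bounded (range (u i \<circ> r)) \<or> filterlim (u i \<circ> r) at_bot sequentially"
    by (metis insertCI)
  show ?case
  proof (cases "filterlim (u j \<circ> r) at_bot sequentially")
    case True
    with r rS show ?thesis by (metis insertE)
  next
    case False
    then obtain L where "\<not> (\<forall>\<^sub>F k in sequentially. (u j \<circ> r) k \<le> L)"
      unfolding filterlim_at_bot by blast
    from not_eventually_sequentiallyD[OF this]
    obtain s :: "nat \<Rightarrow> nat" where s: "strict_mono s" and "\<forall>k. \<not> (u j \<circ> r) (s k) \<le> L"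
      by blast
    then have L: "\<And>k. L < (u j \<circ> r) (s k)" by (simp add: not_le)
    obtain M where M: "\<And>k. u j k \<le> M"
      using insert.prems[of j] by (auto simp: bdd_above_def)
    have "bounded (range (u j \<circ> (r \<circ> s)))"
      by (rule bounded_subset[OF bounded_closed_interval[of L M]])
        (use L M in \<open>auto simp: less_imp_le\<close>)
    moreover have "bounded (range (u i \<circ> (r \<circ> s))) \<or>
        filterlim (u i \<circ> (r \<circ> s)) at_bot sequentially" if "i \<in> S" for i
      using rS[OF that]
    proof
      assume "bounded (range (u i \<circ> r))"
      then have "bounded (range (u i \<circ> (r \<circ> s)))"
        by (rule bounded_subset) auto
      then show ?thesis ..
    next
      assume "filterlim (u i \<circ> r) at_bot sequentially"
      then have "filterlim (u i \<circ> (r \<circ> s)) at_bot sequentially"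
        using filterlim_compose[OF _ filterlim_subseq[OF s]] by (simp add: o_def)
      then show ?thesis ..
    qed
    ultimately show ?thesis using strict_mono_o[OF r s]
      by (intro exI[of _ "r \<circ> s"]) (metis insertE)
  qed
qed

text \<open>The properties shared by the three losses. In the flat case the tail must be eventually
  constant, not merely convergent: the exponential function has infimum 0 and never attains
  it.\<close>

definition coercive_or_flat :: "(real \<Rightarrow> real) \<Rightarrow> bool" where
  "coercive_or_flat g \<longleftrightarrow> continuous_on UNIV g \<and> (\<forall>x. 0 \<le> g x) \<and> filterlim g at_top at_top \<and>
     (filterlim g at_top at_bot \<or> (\<exists>c. \<forall>\<^sub>F x in at_bot. g x = c))"

text \<open>
  Along a minimizing sequence some of the inner products stay bounded and the others tend to
  \<open>-\<infinity>\<close>, where their terms are eventually constant.  Only the component of the sequence in the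
  span of the vectors of the first kind has to converge; keeping the orthogonal component of a
  late enough member of the sequence leaves the other terms at their constant value.
\<close>

lemma sum_coercive_or_flat_attains_Inf:
  fixes x :: "'i \<Rightarrow> 'a::euclidean_space" and g :: "'i \<Rightarrow> real \<Rightarrow> real"
  assumes "finite S" and tame: "\<And>i. i \<in> S \<Longrightarrow> coercive_or_flat (g i)"
  defines "F \<equiv> \<lambda>w. \<Sum>i\<in>S. g i (x i \<bullet> w)"
  shows "\<exists>w. F w = (INF v. F v)"
proof -
  let ?m = "INF v. F v"
  have g_nonneg: "0 \<le> g i t" if "i \<in> S" for i t
    using tame[OF that] by (simp add: coercive_or_flat_def)
  have bdd: "bdd_below (range F)"
    unfolding F_def using g_nonneg by (intro bdd_belowI[of _ 0]) (auto intro: sum_nonneg)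
  have "\<exists>w. F w < ?m + inverse (real (Suc k))" for k
    using cINF_less_iff[OF _ bdd, of "?m + inverse (real (Suc k))"] by simp
  then obtain w where w: "\<And>k. F (w k) < ?m + inverse (real (Suc k))" by metis
  have wlow: "?m \<le> F v" for v by (rule cINF_lower[OF bdd]) simp
  have lim: "(\<lambda>k. F (w k)) \<longlonglongrightarrow> ?m"
  proof (rule tendsto_sandwich[OF _ _ tendsto_const])
    show "(\<lambda>k. ?m + inverse (real (Suc k))) \<longlonglongrightarrow> ?m"
      using tendsto_add[OF tendsto_const[of ?m] LIMSEQ_inverse_real_of_nat] by simp
    show "\<forall>\<^sub>F k in sequentially. F (w k) \<le> ?m + inverse (real (Suc k))"
      using w by (intro always_eventually allI less_imp_le)
    show "\<forall>\<^sub>F k in sequentially. ?m \<le> F (w k)" using wlow by simp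
  qed
  \<comment> \<open>As all terms are nonnegative, each one alone stays bounded along the minimizing
    sequence.\<close>
  have term_le: "g i (x i \<bullet> w k) \<le> ?m + 1" if "i \<in> S" for i k
  proof -
    have "g i (x i \<bullet> w k) \<le> F (w k)"
      unfolding F_def using that g_nonneg assms(1) by (intro member_le_sum) auto
    also have "\<dots> \<le> ?m + inverse (real (Suc k))" using w[of k] by simp
    also have "\<dots> \<le> ?m + 1" by (simp add: inverse_le_1_iff)
    finally show ?thesis .
  qed
  have above: "bdd_above (range (\<lambda>k. x i \<bullet> w k))" if "i \<in> S" for i
  proof -
    have "filterlim (g i) at_top at_top" using tame[OF that] by (simp add: coercive_or_flat_def)
    then obtain B where B: "\<And>t. t \<ge> B \<Longrightarrow> ?m + 1 < g i t"
      unfolding filterlim_at_top_dense eventually_at_top_linorder by meson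
    have "x i \<bullet> w k \<le> B" for k
      using B[of "x i \<bullet> w k"] term_le[OF that, of k] by linarith
    then show ?thesis by (intro bdd_aboveI2)
  qed
  obtain r where r: "strict_mono r" and
    alt: "\<And>i. i \<in> S \<Longrightarrow> bounded (range (\<lambda>k. x i \<bullet> w (r k))) \<or>
                       filterlim (\<lambda>k. x i \<bullet> w (r k)) at_bot sequentially"
    using subseq_bounded_or_at_bot[of S "\<lambda>i k. x i \<bullet> w k"] assms(1) above
    unfolding o_def by blast
  define C where "C = {i \<in> S. bounded (range (\<lambda>k. x i \<bullet> w (r k)))}"
  have C: "C \<subseteq> S" "finite C" using assms(1) by (auto simp: C_def)
  \<comment> \<open>A term that blows up at -infinity would violate \<open>term_le\<close> here, so
    only the flat alternative is left.\<close>
  have "\<exists>c. \<forall>\<^sub>F t in at_bot. g i t = c" if "i \<in> S - C" for i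
  proof -
    have to_bot: "filterlim (\<lambda>k. x i \<bullet> w (r k)) at_bot sequentially"
      using alt that by (auto simp: C_def)
    have "\<not> filterlim (g i) at_top at_bot"
    proof
      assume "filterlim (g i) at_top at_bot"
      from filterlim_compose[OF this to_bot]
      have "\<forall>\<^sub>F k in sequentially. ?m + 1 < g i (x i \<bullet> w (r k))"
        unfolding filterlim_at_top_dense by blast
      then obtain k where "?m + 1 < g i (x i \<bullet> w (r k))"
        by (auto simp: eventually_sequentially)
      with term_le[of i "r k"] that show False by auto
    qed
    then show ?thesis using tame[of i] that by (auto simp: coercive_or_flat_def)
  qed
  then obtain c where c: "\<And>i. i \<in> S - C \<Longrightarrow> \<forall>\<^sub>F t in at_bot. g i t = c i" by metis
  \<comment> \<open>The orthogonal part \<open>z\<close> is invisible to the terms in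
    \<open>C\<close>, and only \<open>y\<close> needs a limit.\<close>
  have "\<exists>y z. y \<in> span (x ` C) \<and> (\<forall>i\<in>C. x i \<bullet> z = 0) \<and> w (r k) = y + z" for k
  proof -
    obtain y z where "y \<in> span (x ` C)" "\<And>v. v \<in> span (x ` C) \<Longrightarrow> orthogonal z v"
        "w (r k) = y + z"
      using orthogonal_subspace_decomp_exists[of "x ` C" "w (r k)"] by metis
    then show ?thesis
      by (metis inner_commute orthogonal_def span_base image_eqI)
  qed
  then obtain y z where y: "\<And>k. y k \<in> span (x ` C)"
    and z: "\<And>k i. i \<in> C \<Longrightarrow> x i \<bullet> z k = 0" and yz: "\<And>k. w (r k) = y k + z k"
    by metis
  have "bounded (range y)"
  proof -
    obtain e where e: "e > 0"
      "\<And>v. v \<in> span (x ` C) \<Longrightarrow> e * norm v \<le> (\<Sum>b\<in>x ` C. \<bar>b \<bullet> v\<bar>)"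
      using norm_le_sum_inner_on_span[of "x ` C"] C(2) by blast
    have "\<exists>M. \<forall>k. \<bar>b \<bullet> y k\<bar> \<le> M" if "b \<in> x ` C" for b
    proof -
      from that obtain i where i: "i \<in> C" "b = x i" by auto
      then obtain M where "\<And>k. \<bar>x i \<bullet> w (r k)\<bar> \<le> M"
        unfolding C_def bounded_iff by auto
      then show ?thesis using i z[OF i(1)] by (auto simp: yz inner_add_right)
    qed
    then obtain M where M: "\<And>b k. b \<in> x ` C \<Longrightarrow> \<bar>b \<bullet> y k\<bar> \<le> M b" by metis
    have "norm (y k) \<le> (\<Sum>b\<in>x ` C. M b) / e" for k
    proof -
      have "e * norm (y k) \<le> (\<Sum>b\<in>x ` C. \<bar>b \<bullet> y k\<bar>)" by (rule e(2)[OF y])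
      also have "\<dots> \<le> (\<Sum>b\<in>x ` C. M b)" by (intro sum_mono M)
      finally show ?thesis using e(1) by (simp add: pos_le_divide_eq mult.commute)
    qed
    then show ?thesis unfolding bounded_iff by blast
  qed
  then obtain l s where s: "strict_mono s" and l: "(y \<circ> s) \<longlonglongrightarrow> l"
    using bounded_imp_convergent_subsequence by metis
  let ?w = "\<lambda>k. w (r (s k))" and ?v = "\<lambda>k. l + z (s k)"
  have flat: "\<forall>\<^sub>F k in sequentially. \<forall>i\<in>S - C. g i (x i \<bullet> ?w k) = c i \<and> g i (x i \<bullet> ?v k) = c i"
  proof (intro eventually_ball_finite ballI)
    fix i assume i: "i \<in> S - C"
    then have "filterlim (\<lambda>k. x i \<bullet> w (r k)) at_bot sequentially"
      using alt by (auto simp: C_def)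
    from filterlim_compose[OF this filterlim_subseq[OF s]]
    have wb: "filterlim (\<lambda>k. x i \<bullet> ?w k) at_bot sequentially" .
    \<comment> \<open>\<open>?v k\<close> and \<open>?w k\<close> differ by
      \<open>l - y (s k)\<close>, which tends to 0, so divergence to -infinity carries over to
      \<open>?v\<close>.\<close>
    have "(\<lambda>k. x i \<bullet> (l - y (s k))) \<longlonglongrightarrow> x i \<bullet> (l - l)"
      using l by (intro tendsto_intros) (simp add: o_def)
    from filterlim_tendsto_add_at_bot_iff[THEN iffD2, OF this wb]
    have vb: "filterlim (\<lambda>k. x i \<bullet> ?v k) at_bot sequentially"
      by (simp add: yz inner_add_right inner_diff_right algebra_simps)
    show "\<forall>\<^sub>F k in sequentially. g i (x i \<bullet> ?w k) = c i \<and> g i (x i \<bullet> ?v k) = c i"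
      using eventually_compose_filterlim[OF c[OF i] wb] eventually_compose_filterlim[OF c[OF i] vb]
      by (rule eventually_conj)
  qed (use assms(1) in simp)
  let ?L = "(\<Sum>i\<in>C. g i (x i \<bullet> l)) + (\<Sum>i\<in>S - C. c i)"
  have F_split: "F v = (\<Sum>i\<in>C. g i (x i \<bullet> v)) + (\<Sum>i\<in>S - C. g i (x i \<bullet> v))" for v
    unfolding F_def using sum.subset_diff[OF C(1) assms(1)] by (simp add: add.commute)
  have "(\<lambda>k. (\<Sum>i\<in>C. g i (x i \<bullet> y (s k))) + (\<Sum>i\<in>S - C. c i)) \<longlonglongrightarrow> ?L"
  proof (intro tendsto_intros)
    fix i assume "i \<in> C"
    then have "isCont (g i) (x i \<bullet> l)"
      using tame[of i] C(1) by (auto simp: coercive_or_flat_def continuous_on_eq_continuous_at)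
    moreover have "(\<lambda>k. x i \<bullet> y (s k)) \<longlonglongrightarrow> x i \<bullet> l"
      using l by (intro tendsto_intros) (simp add: o_def)
    ultimately show "(\<lambda>k. g i (x i \<bullet> y (s k))) \<longlonglongrightarrow> g i (x i \<bullet> l)"
      by (rule isCont_tendsto_compose)
  qed
  moreover have "\<forall>\<^sub>F k in sequentially.
      (\<Sum>i\<in>C. g i (x i \<bullet> y (s k))) + (\<Sum>i\<in>S - C. c i) = F (?w k)"
    using flat by eventually_elim (simp add: F_split yz inner_add_right z)
  ultimately have "(\<lambda>k. F (?w k)) \<longlonglongrightarrow> ?L" by (rule Lim_transform_eventually)
  moreover have "(\<lambda>k. F (?w k)) \<longlonglongrightarrow> ?m"
    using LIMSEQ_subseq_LIMSEQ[OF lim strict_mono_o[OF r s]] by (simp add: o_def)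
  ultimately have "?L = ?m" by (rule LIMSEQ_unique)
  \<comment> \<open>One late \<open>k\<close> suffices: \<open>F (?v k)\<close> equals
    \<open>?L\<close> exactly, not only in the limit.\<close>
  moreover obtain k where "\<forall>i\<in>S - C. g i (x i \<bullet> ?v k) = c i"
    using eventually_happens'[OF _ flat] by auto
  then have "F (?v k) = ?L" by (simp add: F_split inner_add_right z)
  ultimately show ?thesis by metis
qed

section \<open>Attainment for the concrete losses and objectives\<close>

lemma coercive_or_flat_square: "coercive_or_flat (\<lambda>x. (x - y)\<^sup>2)"
proof -
  have t: "filterlim (\<lambda>x. x - y) at_top at_top" for y :: real
    using filterlim_tendsto_add_at_top[OF tendsto_const filterlim_ident, of "- y"] by simp
  have b: "filterlim (\<lambda>x. x - y) at_bot at_bot" for y :: real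
    using filterlim_tendsto_add_at_bot_iff[OF tendsto_const, of "- y" "\<lambda>x. x" at_bot]
    by (simp add: filterlim_ident)
  have "filterlim (\<lambda>x. (x - y)\<^sup>2) at_top at_bot"
    using filterlim_pow_at_bot_even[OF _ b] by simp
  with filterlim_pow_at_top[OF _ t, of 2 y] show ?thesis
    by (auto simp: coercive_or_flat_def intro!: continuous_intros)
qed

lemma coercive_or_flat_relu: "coercive_or_flat (\<lambda>x. (max 0 x - y)\<^sup>2)"
proof -
  have "\<forall>\<^sub>F x in at_top. (x - y)\<^sup>2 = (max 0 x - y)\<^sup>2"
    by (rule eventually_mono[OF eventually_ge_at_top[of 0]]) simp
  then have "filterlim (\<lambda>x. (max 0 x - y)\<^sup>2) at_top at_top"
    using coercive_or_flat_square[of y]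
    by (auto simp: coercive_or_flat_def intro: filterlim_cong[THEN iffD1, rotated -1])
  moreover have "\<forall>\<^sub>F x in at_bot. (max 0 x - y)\<^sup>2 = y\<^sup>2"
    by (rule eventually_mono[OF eventually_le_at_bot[of 0]]) (simp add: max_absorb1)
  ultimately show ?thesis
    by (auto simp: coercive_or_flat_def intro!: continuous_intros)
qed

lemma coercive_or_flat_sigma: "coercive_or_flat (\<lambda>x. sigma x y)"
proof -
  have "\<forall>\<^sub>F x in at_top. (x - y)\<^sup>2 = sigma x y"
    by (rule eventually_mono[OF eventually_gt_at_top[of "2 * y"]]) (simp add: sigma_def)
  then have "filterlim (\<lambda>x. sigma x y) at_top at_top"
    using coercive_or_flat_square[of y]
    by (auto simp: coercive_or_flat_def intro: filterlim_cong[THEN iffD1, rotated -1])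
  moreover have "\<forall>\<^sub>F x in at_bot. sigma x y = y\<^sup>2"
    by (rule eventually_mono[OF eventually_le_at_bot[of "2 * y"]]) (simp add: sigma_def)
  moreover have "continuous_on UNIV (\<lambda>x. sigma x y)"
    unfolding sigma_altdef by (intro continuous_intros)
  ultimately show ?thesis by (auto simp: coercive_or_flat_def sigma_altdef)
qed

text \<open>Appending the coordinate 1 makes the preactivation linear in the weights, as the
  attainment result requires.\<close>

lemma aff_eq_inner: "aff x w = (x, 1) \<bullet> w"
  by (cases w) (simp add: aff_def)

lemma relu_obj_attains: "\<exists>w. relu_obj n X Y w = z_opt n X Y"
  unfolding relu_obj_def z_opt_def aff_eq_inner
  by (rule sum_coercive_or_flat_attains_Inf[where g = "\<lambda>i x. (max 0 x - Y i)\<^sup>2"])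
    (simp_all add: coercive_or_flat_relu)

lemma f_sigma_phi_attains:
  assumes "m \<le> n" "I \<subseteq> {1..m}"
  shows "\<exists>w. f_sigma m X Y I w + phi m n X Y w = z_sigma m n X Y I"
proof -
  let ?g = "\<lambda>i x. if i \<in> I then (x - Y i)\<^sup>2
    else if i \<le> m then sigma x (Y i) else (max 0 x - Y i)\<^sup>2"
  have "coercive_or_flat (?g i)" for i
    using coercive_or_flat_square coercive_or_flat_sigma coercive_or_flat_relu
    by (cases "i \<in> I"; cases "i \<le> m") simp_all
  then show ?thesis
    unfolding z_sigma_def f_sigma_phi_eq_sum[OF assms] aff_eq_inner
    by (intro sum_coercive_or_flat_attains_Inf[where g = ?g]) simp_all
qed

section \<open>Existence and quality of the output\<close>

lemma ex_gen_approx_output: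
  assumes "m \<le> n" and "\<forall>i\<in>{1..m}. 0 < Y i" and "mono_on {1..m} Y"
    and "1 \<le> k" and "k \<le> n"
  shows "\<exists>w. gen_approx_output k m n X Y w"
proof -
  have "examined_sets k m \<subseteq> Pow {1..m}" using examined_sets_bounds by blast
  then have "finite (examined_sets k m)" by (rule finite_subset) simp
  \<comment> \<open>The ratio bound, at an arbitrary point, already exhibits an examined
    set.\<close>
  moreover have "examined_sets k m \<noteq> {}"
    using ex_examined_set_le[OF assms] by blast
  ultimately obtain I where I: "is_arg_min (z_sigma m n X Y) (\<lambda>J. J \<in> examined_sets k m) I"
    using ex_is_arg_min_if_finite by blast
  then have Im: "I \<subseteq> {1..m}" by (intro examined_sets_bounds[of _ k]) (simp add: is_arg_min_def)
  obtain w where "f_sigma m X Y I w + phi m n X Y w = z_sigma m n X Y I"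
    using f_sigma_phi_attains[OF assms(1) Im] by blast
  then have "is_arg_min (\<lambda>v. f_sigma m X Y I v + phi m n X Y v) (\<lambda>_. True) w"
    using z_sigma_le[of m n X Y I] by (simp add: is_arg_min_linorder)
  with I show ?thesis unfolding gen_approx_output_def by blast
qed

text \<open>The good set \<open>J\<close> depends on an unknown optimal \<open>v\<close>. It enters
  only through the comparison of \<open>z_sigma\<close> values, where minimality of \<open>I\<close>
  over all examined sets suffices.\<close>

lemma gen_approx_output_le:
  assumes "m \<le> n" and "\<forall>i\<in>{1..m}. 0 < Y i" and "mono_on {1..m} Y"
    and "1 \<le> k" and "k \<le> n"
    and "gen_approx_output k m n X Y w"
  shows "relu_obj n X Y w \<le> real n / real k * z_opt n X Y"
proof -
  obtain I where I: "I \<in> examined_sets k m"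
    and I_min: "\<And>J. J \<in> examined_sets k m \<Longrightarrow> z_sigma m n X Y I \<le> z_sigma m n X Y J"
    and w_min: "\<And>v. f_sigma m X Y I w + phi m n X Y w \<le> f_sigma m X Y I v + phi m n X Y v"
    using assms(6) by (auto simp: gen_approx_output_def is_arg_min_linorder)
  have Im: "I \<subseteq> {1..m}" using I by (rule examined_sets_bounds)
  obtain v where v: "relu_obj n X Y v = z_opt n X Y" using relu_obj_attains by blast
  obtain J where J: "J \<in> examined_sets k m"
    and J_le: "f_sigma m X Y J v + phi m n X Y v \<le> real n / real k * relu_obj n X Y v"
    using ex_examined_set_le[OF assms(1-5)] by blast
  have "relu_obj n X Y w \<le> f_sigma m X Y I w + phi m n X Y w"
    using assms(1,2) Im by (intro relu_obj_le_f_sigma_phi)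
  also have "\<dots> \<le> z_sigma m n X Y I"
    unfolding z_sigma_def by (rule cINF_greatest) (auto intro: w_min)
  also have "\<dots> \<le> z_sigma m n X Y J" by (rule I_min[OF J])
  also have "\<dots> \<le> f_sigma m X Y J v + phi m n X Y v"
    by (rule z_sigma_le)
  also note J_le
  finally show ?thesis by (simp add: v)
qed

theorem theorem2:
  fixes X :: "nat \<Rightarrow> real ^ 'p" and Y :: "nat \<Rightarrow> real" and k m n :: nat
  assumes "m \<le> n"
    and "\<forall>i\<in>{1..m}. 0 < Y i"
    and "mono_on {1..m} Y"
    and "\<forall>i\<in>{m+1..n}. Y i \<le> 0"
    and "1 \<le> k" and "k \<le> n"
  shows "(\<exists>w. relu_obj n X Y w = z_opt n X Y) \<and>
         (\<exists>w. gen_approx_output k m n X Y w) \<and>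
         (\<forall>w. gen_approx_output k m n X Y w \<longrightarrow>
            z_opt n X Y \<le> relu_obj n X Y w \<and>
            relu_obj n X Y w \<le> real n / real k * z_opt n X Y)"
  using relu_obj_attains z_opt_le ex_gen_approx_output[OF assms(1-3,5,6)]
    gen_approx_output_le[OF assms(1-3,5,6)] by blast

end
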